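(* Let $d\ge 1$ be an integer, let $\alpha>d$ and $\lambda>0$, and let $(W_x)_{x\in\mathbb{Z}^d}$ be i.i.d. non-negative random variables, distributed as $W$. Assume that there exist $\tau>1$ and $c>0$ such that $$\mathbb{P}(W>w)\le c\,w^{-(\tau-1)}\quad\text{for all } w>0,$$ and such that $\gamma:=\alpha(\tau-1)/d\in(1,2)$. Set $\kappa=\gamma-1$ if $\tau\in(1,2]$ and $\kappa=\alpha/d-1$ if $\tau>2$. Then, for the random graph with edge probabilities $p_{xy}=1-\exp\{-\lambda W_xW_y/|x-y|^{\alpha}\}$ and for every $\eta>0$, $$\lim_{|x|\to\infty}\mathbb{P}\Big(d(0,x)\ge (1-\eta)\frac{2\log\log|x|}{|\log\kappa|}\Big)=1.$$
   Context: The random graph has vertex set $\mathbb{Z}^d$; conditionally on the weights $(W_x)_{x\in\mathbb{Z}^d}$, the edges between distinct vertices $x,y$ are independently present (occupied) with probability $p_{xy}=1-\exp\{-\lambda W_xW_y/|x-y|^{\alpha}\}$, where $|\cdot|$ is the Euclidean norm. The graph distance $d(0,x)$ is the minimum number of occupied edges forming a path from $0$ to $x$, with $d(0,x)=\infty$ if $0$ and $x$ are not connected (the integer $d$ without arguments is the dimension). The limit is over $x\in\mathbb{Z}^d$ with $|x|\to\infty$. Standing normalization: if the weights have finite mean, they are normalized so that $\mathbb{E}[W]=1$ (for non-degenerate weights this amounts only to rescaling $\lambda$). *)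

theory Defs
  imports "HOL-Probability.Probability" "HOL-Library.Extended_Nat"
begin

definition lattice_norm :: "int ^ 'd::finite \<Rightarrow> real" where
  "lattice_norm x = norm ((\<chi> i. real_of_int (x $ i)) :: real ^ 'd)"

text \<open>An undirected graph is represented by its set of edges, each edge being a two-element set
  of vertices. A path is given by the list of the vertices that it visits.\<close>

definition is_path :: "'v set set \<Rightarrow> 'v \<Rightarrow> 'v list \<Rightarrow> 'v \<Rightarrow> bool" where
  "is_path E x vs y \<longleftrightarrow>
     vs \<noteq> [] \<and> hd vs = x \<and> last vs = y \<and> distinct vs \<and> successively (\<lambda>u v. {u, v} \<in> E) vs"

text \<open>The infimum over the empty set is \<open>\<infinity>\<close>, which is the value for
  vertices that are not connected.\<close>

definition graph_dist :: "'v set set \<Rightarrow> 'v \<Rightarrow> 'v \<Rightarrow> enat" where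
  "graph_dist E x y = (INF vs \<in> {vs. is_path E x vs y}. enat (length vs - 1))"

definition edge_prob ::
    "real \<Rightarrow> real \<Rightarrow> (int ^ 'd::finite \<Rightarrow> real) \<Rightarrow> int ^ 'd \<Rightarrow> int ^ 'd \<Rightarrow> real" where
  "edge_prob lam \<alpha> w x y = 1 - exp (- (lam * w x * w y / lattice_norm (x - y) powr \<alpha>))"

text \<open>
  \<open>D\<close> is the common law of the weights \<open>W x\<close>, and \<open>G \<omega>\<close> is the random set of occupied edges.
  The last assumption says that, given the weights, the edges are independently occupied
  with probabilities \<^const>\<open>edge_prob\<close>: the conditional probability that finitely many given
  edges are all occupied is the product of their edge probabilities. The set \<open>F\<close> consists of
  ordered pairs, and injectivity ensures that no undirected edge is listed in both orientations.
\<close>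

locale scale_free_percolation = prob_space M
  for M :: "'a measure" +
  fixes lam \<alpha> :: real
    and D :: "real measure"
    and W :: "int ^ 'd::finite \<Rightarrow> 'a \<Rightarrow> real"
    and G :: "'a \<Rightarrow> (int ^ 'd) set set"
  assumes weights_indep: "indep_vars (\<lambda>_. borel) W UNIV"
    and weights_law: "\<And>x. distr M borel (W x) = D"
    and weights_nonneg: "AE w in D. 0 \<le> w"
    and edges: "\<And>\<omega>. \<omega> \<in> space M \<Longrightarrow> G \<omega> \<subseteq> {{x, y} | x y. x \<noteq> y}"
    and edge_events: "\<And>x y. x \<noteq> y \<Longrightarrow> {\<omega> \<in> space M. {x, y} \<in> G \<omega>} \<in> sets M"
    and edges_cond_indep:
      "\<And>F. finite F \<Longrightarrow> (\<And>x y. (x, y) \<in> F \<Longrightarrow> x \<noteq> y) \<Longrightarrow> inj_on (\<lambda>(x, y). {x, y}) F \<Longrightarrow>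
        AE \<omega> in M.
          real_cond_exp M
            (vimage_algebra (space M) (\<lambda>\<omega> x. W x \<omega>) (Pi\<^sub>M UNIV (\<lambda>_. borel)))
            (indicator {\<omega> \<in> space M. \<forall>(x, y) \<in> F. {x, y} \<in> G \<omega>}) \<omega>
          = (\<Prod>(x, y) \<in> F. edge_prob lam \<alpha> (\<lambda>z. W z \<omega>) x y)"

end

theory Submission
  imports Defs "HOL-Real_Asymp.Real_Asymp"
begin

text \<open>
  The proof is a first-moment argument on long edges. Since \<open>1 - exp (- u) \<le> u powr \<beta>\<close> for
  \<open>0 < \<beta> \<le> 1\<close>, an edge between \<open>y\<close> and \<open>z\<close> is occupied with probability at most
  \<open>K \<bar>y - z\<bar> powr (- \<alpha> \<beta>)\<close>, where \<open>K\<close> contains the square of the \<open>\<beta>\<close>-th moment of a weight. This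
  moment is finite as soon as \<open>\<beta> < \<tau> - 1\<close>, so every \<open>\<beta>\<close> below \<open>min (\<tau> - 1) 1\<close> is admissible
  (\<open>prob_edge_le\<close>). The two cases in the definition of \<open>\<kappa>\<close> are the two values of this minimum:
  \<open>\<kappa> = \<alpha> min (\<tau> - 1) 1 / d - 1\<close>.

  Consequently the expected number of edges that lead from the ball of radius \<open>R\<close> to the outside
  of the ball of radius \<open>R'\<close> about the same centre is at most about \<open>R powr d * R' powr (d - \<alpha> \<beta>)\<close>
  (\<open>prob_long_edge_le\<close>). This is small when \<open>R' = R powr q\<close> with \<open>q > 1 / \<kappa>\<close>, provided that
  \<open>\<beta>\<close> is close to its upper limit. Along the radii \<open>R k = exp (h * q ^ k)\<close> these bounds are
  summable over \<open>k\<close>, with a sum of order \<open>1 / h\<close> (\<open>prob_escape_le\<close>). With probability close to 1,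
  therefore, \<open>n\<close> steps from a given vertex never leave the ball of radius \<open>R n\<close> around it.

  This is applied around both endpoints, which is where the factor 2 comes from: a path of
  at most \<open>2 n\<close> edges between \<open>0\<close> and \<open>x\<close> has a vertex within \<open>n\<close> steps of both endpoints,
  which is impossible when \<open>2 R n < \<bar>x\<bar>\<close> (\<open>graph_dist_ge_if_confined\<close>). Let
  \<open>\<eta> < 1\<close>, the claim being trivial otherwise. With \<open>ln q = (1 + \<eta>) \<bar>ln \<kappa>\<bar>\<close> and \<open>n\<close> about
  \<open>(1 - \<eta>) ln (ln \<bar>x\<bar>) / \<bar>ln \<kappa>\<bar>\<close>, the number \<open>ln (R n)\<close> is of order \<open>(ln \<bar>x\<bar>) powr (1 - \<eta>\<^sup>2)\<close>,
  hence \<open>2 R n < \<bar>x\<bar>\<close> for all large \<open>\<bar>x\<bar>\<close>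
  (\<open>eventually_iterated_radius_lt\<close>).
\<close>

section \<open>Lattice sums\<close>

lemma lattice_norm_nonneg: "0 \<le> lattice_norm u"
  by (simp add: lattice_norm_def)

lemma lattice_norm_zero: "lattice_norm 0 = 0"
  by (simp add: lattice_norm_def vec_eq_iff flip: zero_vec_def)

lemma lattice_norm_minus: "lattice_norm (u - v) = lattice_norm (v - u)"
proof -
  have "(\<chi> i. real_of_int ((u - v) $ i)) = - (\<chi> i. real_of_int ((v - u) $ i))"
    by (simp add: vec_eq_iff)
  then show ?thesis
    unfolding lattice_norm_def by (metis norm_minus_cancel)
qed

lemma lattice_norm_triangle: "lattice_norm (u + v) \<le> lattice_norm u + lattice_norm v"
proof -
  have "(\<chi> i. real_of_int ((u + v) $ i)) =
      (\<chi> i. real_of_int (u $ i)) + (\<chi> i. real_of_int (v $ i))"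
    by (simp add: vec_eq_iff)
  then show ?thesis
    unfolding lattice_norm_def by (metis norm_triangle_ineq)
qed

lemma abs_component_le_lattice_norm: "\<bar>real_of_int (u $ i)\<bar> \<le> lattice_norm u"
  using component_le_norm_cart[of "\<chi> i. real_of_int (u $ i)" i] by (simp add: lattice_norm_def)

lemma sum_int_powr_bounded:
  fixes t :: real
  assumes "1 < t"
  obtains T where "\<And>K :: int set. finite K \<Longrightarrow> (\<Sum>k\<in>K. max 1 \<bar>real_of_int k\<bar> powr (- t)) \<le> T"
proof -
  define g where "g n = max 1 (real n) powr (- t)" for n
  have "summable (\<lambda>n. real n powr (- t))"
    using assms by (simp add: summable_real_powr_iff)
  then have "summable g"
    by (rule summable_cong[THEN iffD1, rotated])
      (auto simp: g_def max_def eventually_at_top_linorder intro!: exI[of _ 1])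
  have "(\<Sum>k\<in>K. max 1 \<bar>real_of_int k\<bar> powr (- t)) \<le> 2 * suminf g" if "finite K" for K :: "int set"
  proof -
    have half: "(\<Sum>k\<in>L. max 1 \<bar>real_of_int k\<bar> powr (- t)) \<le> suminf g"
      if "finite L" "inj_on (\<lambda>k. nat \<bar>k\<bar>) L" for L :: "int set"
    proof -
      have "(\<Sum>k\<in>L. max 1 \<bar>real_of_int k\<bar> powr (- t)) = sum g ((\<lambda>k. nat \<bar>k\<bar>) ` L)"
        by (subst sum.reindex[OF that(2)]) (simp add: g_def)
      also have "\<dots> \<le> suminf g"
        using that by (intro sum_le_suminf \<open>summable g\<close>) (auto simp: g_def)
      finally show ?thesis .
    qed
    have "K = {k\<in>K. 0 \<le> k} \<union> {k\<in>K. k < 0}"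
      by auto
    then have "(\<Sum>k\<in>K. max 1 \<bar>real_of_int k\<bar> powr (- t)) =
        (\<Sum>k\<in>{k\<in>K. 0 \<le> k}. max 1 \<bar>real_of_int k\<bar> powr (- t)) +
        (\<Sum>k\<in>{k\<in>K. k < 0}. max 1 \<bar>real_of_int k\<bar> powr (- t))"
      using that by (metis (no_types, lifting) sum.union_disjoint disjoint_iff finite_Un
          mem_Collect_eq not_less)
    also have "\<dots> \<le> suminf g + suminf g"
      using that by (intro add_mono half) (auto simp: inj_on_def)
    finally show ?thesis by simp
  qed
  then show thesis by (rule that)
qed

text \<open>
  The Euclidean norm dominates every coordinate, so the summand is at most a product of
  one-dimensional summands with exponent \<open>s / d > 1\<close>, and the sum over a box factorizes.
\<close>

lemma lattice_sum_bounded: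
  fixes s :: real
  assumes "real CARD('d::finite) < s"
  obtains S where "0 < S"
    "\<And>A :: (int ^ 'd) set. finite A \<Longrightarrow> (\<Sum>u\<in>A. max 1 (lattice_norm u) powr (- s)) \<le> S"
proof -
  let ?t = "s / real CARD('d)"
  have "1 < ?t" using assms by simp
  obtain T where T: "\<And>K :: int set. finite K \<Longrightarrow> (\<Sum>k\<in>K. max 1 \<bar>real_of_int k\<bar> powr (- ?t)) \<le> T"
    using sum_int_powr_bounded[OF \<open>1 < ?t\<close>] by blast
  have "(\<Sum>u\<in>A. max 1 (lattice_norm u) powr (- s)) \<le> (max 1 T) ^ CARD('d)"
    if "finite A" for A :: "(int ^ 'd) set"
  proof -
    define K where "K = (\<Union>u\<in>A. range (($) u))"
    have "finite K" using that by (auto simp: K_def)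
    have pt: "max 1 (lattice_norm u) powr (- s)
        \<le> (\<Prod>i\<in>UNIV. max 1 \<bar>real_of_int (u $ i)\<bar> powr (- ?t))" for u :: "int ^ 'd"
    proof -
      have "max 1 (lattice_norm u) powr (- s) =
          (\<Prod>i\<in>(UNIV :: 'd set). max 1 (lattice_norm u) powr (- ?t))"
        by (simp add: powr_realpow[symmetric] powr_powr)
      also have "\<dots> \<le> (\<Prod>i\<in>UNIV. max 1 \<bar>real_of_int (u $ i)\<bar> powr (- ?t))"
        using \<open>1 < ?t\<close> abs_component_le_lattice_norm[of u]
        by (intro prod_mono conjI powr_mono2') (auto simp: max_def intro: order_trans)
      finally show ?thesis .
    qed
    have "(\<Sum>u\<in>A. max 1 (lattice_norm u) powr (- s)) \<le>
        (\<Sum>u\<in>A. \<Prod>i\<in>UNIV. max 1 \<bar>real_of_int (u $ i)\<bar> powr (- ?t))"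
      by (intro sum_mono pt)
    also have "\<dots> = (\<Sum>f\<in>($) ` A. \<Prod>i\<in>UNIV. max 1 \<bar>real_of_int (f i)\<bar> powr (- ?t))"
      by (subst sum.reindex) (auto simp: inj_on_def vec_nth_inject)
    also have "\<dots> \<le> (\<Sum>f\<in>Pi\<^sub>E (UNIV :: 'd set) (\<lambda>_. K). \<Prod>i\<in>UNIV. max 1 \<bar>real_of_int (f i)\<bar> powr (- ?t))"
      using \<open>finite K\<close> by (intro sum_mono2 finite_PiE prod_nonneg)
        (auto simp: K_def PiE_UNIV_domain)
    also have "\<dots> = (\<Prod>i\<in>(UNIV :: 'd set). \<Sum>k\<in>K. max 1 \<bar>real_of_int k\<bar> powr (- ?t))"
      using \<open>finite K\<close> by (subst prod_sum_PiE) auto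
    also have "\<dots> \<le> (\<Prod>i\<in>(UNIV :: 'd set). max 1 T)"
      using T[OF \<open>finite K\<close>] by (intro prod_mono conjI sum_nonneg) (auto simp: max_def)
    finally show ?thesis by simp
  qed
  then show thesis by (intro that[of "(max 1 T) ^ CARD('d)"]) (auto simp: max_def)
qed

section \<open>Moments and elementary bounds\<close>

text \<open>
  Dyadic layers: a number above 1 lies in \<open>{2 ^ k<..2 ^ Suc k}\<close> for some \<open>k\<close>, so the moment is at
  most \<open>1\<close> plus the sum over \<open>k\<close> of \<open>2 powr (\<beta> * Suc k) * prob {2 ^ k<..}\<close>, and the tail bound
  turns this sum into a geometric series of ratio \<open>2 powr (\<beta> - t)\<close>.
\<close>

lemma (in real_distribution) fractional_moment_finite:
  fixes t \<beta> c :: real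
  assumes tail: "\<And>w. 0 < w \<Longrightarrow> prob {w<..} \<le> c * w powr (- t)"
    and "0 < \<beta>" "\<beta> < t"
  shows "integrable M (\<lambda>w. max 0 w powr \<beta>)"
proof (rule integrableI_bounded)
  let ?b = "\<lambda>k w. ennreal (2 powr (\<beta> * real (Suc k))) * indicator {2 ^ k<..} w"
  have "(\<integral>\<^sup>+w. ennreal (norm (max 0 w powr \<beta>)) \<partial>M) \<le> (\<integral>\<^sup>+w. 1 + (\<Sum>k. ?b k w) \<partial>M)"
  proof (rule nn_integral_mono)
    fix w
    have term_le: "f k \<le> (\<Sum>j. f j)" for f :: "nat \<Rightarrow> ennreal" and k
      using sum_le_suminf[of f "{k}"] by simp
    show "ennreal (norm (max 0 w powr \<beta>)) \<le> 1 + (\<Sum>k. ?b k w)"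
    proof (cases "w \<le> 1")
      case True
      then have "max 0 w powr \<beta> \<le> 1"
        using \<open>0 < \<beta>\<close> by (intro powr_le1) auto
      then have "ennreal (norm (max 0 w powr \<beta>)) \<le> 1 + 0"
        by (simp add: ennreal_le_1)
      also have "\<dots> \<le> 1 + (\<Sum>k. ?b k w)"
        by (intro add_left_mono) simp
      finally show ?thesis .
    next
      case False
      obtain m where "w < 2 ^ m"
        using real_arch_pow[of 2 w] by auto
      (* The layer that contains w. *)
      define n where "n = (LEAST n. w \<le> 2 ^ n)"
      have n: "w \<le> 2 ^ n"
        unfolding n_def
        by (rule LeastI[where P = "\<lambda>n. w \<le> 2 ^ n" and k = m]) (use \<open>w < 2 ^ m\<close> in simp)
      have "n \<noteq> 0" using n False by (intro notI) simp
      then obtain k where k: "n = Suc k" by (cases n) auto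
      have "2 ^ k < w"
      proof -
        have "\<not> w \<le> 2 ^ k"
          by (rule not_less_Least) (simp add: n_def[symmetric] k)
        then show ?thesis by simp
      qed
      have "max 0 w powr \<beta> \<le> (2 ^ Suc k) powr \<beta>"
        using n k False \<open>0 < \<beta>\<close> by (intro powr_mono2) auto
      also have "\<dots> = 2 powr (\<beta> * real (Suc k))"
        by (subst powr_realpow[symmetric]) (simp_all add: powr_powr mult.commute del: power_Suc)
      finally have "ennreal (norm (max 0 w powr \<beta>)) \<le> ?b k w"
        using \<open>2 ^ k < w\<close> by (simp add: ennreal_leI)
      also have "\<dots> \<le> (\<Sum>k. ?b k w)"
        by (rule term_le)
      also have "\<dots> \<le> 1 + (\<Sum>k. ?b k w)"
        by (simp add: add_increasing)
      finally show ?thesis .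
    qed
  qed
  also have "\<dots> = 1 + (\<Sum>k. \<integral>\<^sup>+w. ?b k w \<partial>M)"
    by (simp add: nn_integral_add nn_integral_suminf emeasure_space_1[simplified])
  also have "(\<Sum>k. \<integral>\<^sup>+w. ?b k w \<partial>M) \<le> (\<Sum>k. ennreal (2 powr \<beta> * c * (2 powr (\<beta> - t)) ^ k))"
  proof (rule suminf_le)
    fix k :: nat
    have "(\<integral>\<^sup>+w. ?b k w \<partial>M) = ennreal (2 powr (\<beta> * real (Suc k)) * prob {2 ^ k<..})"
      by (subst nn_integral_cmult_indicator) (auto simp: emeasure_eq_measure ennreal_mult)
    also have "\<dots> \<le> ennreal (2 powr (\<beta> * real (Suc k)) * (c * (2 ^ k) powr (- t)))"
      by (intro ennreal_leI mult_left_mono tail) auto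
    also have "2 powr (\<beta> * real (Suc k)) * (c * (2 ^ k) powr (- t)) =
        2 powr \<beta> * c * (2 powr (\<beta> - t)) ^ k"
    proof -
      have "(2 ^ k) powr (- t) = 2 powr (- (t * real k))"
        by (subst powr_realpow[symmetric]) (simp_all add: powr_powr mult.commute)
      moreover have "(2 powr (\<beta> - t)) ^ k = 2 powr (real k * (\<beta> - t))"
        by (simp add: powr_power)
      moreover have "2 powr (\<beta> * real (Suc k)) * 2 powr (- (t * real k)) =
          2 powr \<beta> * 2 powr (real k * (\<beta> - t))"
        by (simp add: powr_add[symmetric] algebra_simps)
      ultimately show ?thesis by (simp add: mult_ac)
    qed
    finally show "(\<integral>\<^sup>+w. ?b k w \<partial>M) \<le> ennreal (2 powr \<beta> * c * (2 powr (\<beta> - t)) ^ k)" .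
  qed auto
  also have "(\<Sum>k. ennreal (2 powr \<beta> * c * (2 powr (\<beta> - t)) ^ k)) < \<infinity>"
  proof -
    have "0 \<le> c"
      using order_trans[OF measure_nonneg tail[of 1]] by simp
    have "summable (\<lambda>k. 2 powr \<beta> * c * (2 powr (\<beta> - t)) ^ k)"
      using \<open>\<beta> < t\<close> powr_less_mono[of "\<beta> - t" 0 2]
      by (intro summable_mult summable_geometric) auto
    then show ?thesis
      using \<open>0 \<le> c\<close> by (subst suminf_ennreal2) auto
  qed
  finally show "(\<integral>\<^sup>+w. ennreal (norm (max 0 w powr \<beta>)) \<partial>M) < \<infinity>"
    by (simp add: ennreal_add_less_top add_left_mono)
qed measurable

text \<open>
  Bounding finite partial sums suffices for a countable union bound, by continuity from below.
  In this form the lattice sums below are only ever taken over finite sets.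
\<close>

lemma (in finite_measure) measure_countable_UN_le:
  assumes "countable I" and meas: "\<And>i. i \<in> I \<Longrightarrow> A i \<in> sets M"
    and bound: "\<And>J. finite J \<Longrightarrow> J \<subseteq> I \<Longrightarrow> (\<Sum>i\<in>J. measure M (A i)) \<le> b"
  shows "measure M (\<Union>i\<in>I. A i) \<le> b"
proof -
  define J where "J n = {i \<in> I. to_nat_on I i < n}" for n
  have fin: "finite (J n)" for n
    unfolding J_def using inj_on_to_nat_on[OF \<open>countable I\<close>]
    by (intro finite_imageD[of "to_nat_on I"])
      (auto intro: finite_subset[of _ "{..<n}"] inj_on_subset)
  have "(\<lambda>n. measure M (\<Union>i\<in>J n. A i)) \<longlonglongrightarrow> measure M (\<Union>n. \<Union>i\<in>J n. A i)"
  proof (rule finite_Lim_measure_incseq)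
    show "range (\<lambda>n. \<Union>i\<in>J n. A i) \<subseteq> sets M"
      using fin meas by (auto simp: J_def intro!: sets.finite_UN)
    show "incseq (\<lambda>n. \<Union>i\<in>J n. A i)"
      by (auto simp: incseq_def J_def)
  qed
  also have "(\<Union>n. \<Union>i\<in>J n. A i) = (\<Union>i\<in>I. A i)"
    by (auto simp: J_def)
  finally show ?thesis
  proof (rule LIMSEQ_le_const2, intro exI allI impI)
    fix n
    have "measure M (\<Union>i\<in>J n. A i) \<le> (\<Sum>i\<in>J n. measure M (A i))"
      using fin meas by (intro measure_UNION_le) (auto simp: J_def)
    also have "\<dots> \<le> b"
      using fin by (intro bound) (auto simp: J_def)
    finally show "measure M (\<Union>i\<in>J n. A i) \<le> b" .
  qed
qed

text \<open>
  This is the interpolation between the bounds \<open>1\<close> and \<open>u\<close> that trades decay in the distance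
  against integrability of the weights.
\<close>

lemma one_minus_exp_le_powr:
  fixes u \<beta> :: real
  assumes "0 \<le> u" "0 < \<beta>" "\<beta> \<le> 1"
  shows "1 - exp (- u) \<le> u powr \<beta>"
proof (cases "1 \<le> u")
  case True
  then show ?thesis
    using assms ge_one_powr_ge_zero[of u \<beta>] exp_gt_zero[of "- u"] by linarith
next
  case False
  have "1 - exp (- u) \<le> u"
    using exp_ge_add_one_self[of "- u"] by simp
  also have "\<dots> \<le> u powr \<beta>"
    using assms False powr_mono'[of \<beta> 1 u] by (cases "u = 0") auto
  finally show ?thesis .
qed

section \<open>Confinement of short paths\<close>

lemma path_confined:
  assumes no_long: "\<And>k y z. k < n \<Longrightarrow> lattice_norm (y - v) \<le> R k \<Longrightarrow> {y, z} \<in> E \<Longrightarrow>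
      lattice_norm (z - v) \<le> R (Suc k)"
    and "0 \<le> R 0" and steps: "successively (\<lambda>a b. {a, b} \<in> E) vs" and "hd vs = v"
    and "i < length vs" "i \<le> n"
  shows "lattice_norm (vs ! i - v) \<le> R i"
  using \<open>i < length vs\<close> \<open>i \<le> n\<close>
proof (induction i)
  case 0
  then show ?case
    using assms(2,4) by (simp add: hd_conv_nth[symmetric] lattice_norm_zero)
next
  case (Suc i)
  then have "{vs ! i, vs ! Suc i} \<in> E"
    using steps by (simp add: successively_conv_nth)
  with Suc show ?case
    by (intro no_long[of i "vs ! i"]) auto
qed

text \<open>
  A path that is too short has a vertex \<open>vs ! i\<close> within \<open>n\<close> steps of both of its ends, hence within
  \<open>R n\<close> of both, against the triangle inequality. The reversed path gives the bound at the far end.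
\<close>

lemma graph_dist_ge_if_confined:
  assumes no_long: "\<And>w k y z. w \<in> {u, v} \<Longrightarrow> k < n \<Longrightarrow> lattice_norm (y - w) \<le> R k \<Longrightarrow>
      {y, z} \<in> E \<Longrightarrow> lattice_norm (z - w) \<le> R (Suc k)"
    and "0 \<le> R 0" "mono R" "2 * R n < lattice_norm (v - u)"
  shows "enat (2 * n) \<le> graph_dist E u v"
  unfolding graph_dist_def
proof (rule INF_greatest)
  fix vs assume "vs \<in> {vs. is_path E u vs v}"
  then have vs: "vs \<noteq> []" "hd vs = u" "last vs = v" "successively (\<lambda>a b. {a, b} \<in> E) vs"
    by (auto simp: is_path_def)
  have "2 * n \<le> length vs - 1"
  proof (rule ccontr)
    assume short: "\<not> 2 * n \<le> length vs - 1"
    define m where "m = length vs - 1"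
    define i where "i = min n m"
    have i: "i \<le> n" "m - i \<le> n" "i \<le> m" "Suc m = length vs"
      using short vs(1) by (auto simp: i_def m_def)
    have "lattice_norm (vs ! i - u) \<le> R i"
      using i by (intro path_confined[where n = n and E = E and vs = vs] no_long[of u] assms vs) auto
    moreover have "lattice_norm (rev vs ! (m - i) - v) \<le> R (m - i)"
      using i vs
      by (intro path_confined[where n = n and E = E and vs = "rev vs"] no_long[of v] assms)
        (auto simp: hd_rev insert_commute)
    moreover have "rev vs ! (m - i) = vs ! i"
      using i by (simp add: rev_nth)
    moreover have "R i \<le> R n" "R (m - i) \<le> R n"
      using i \<open>mono R\<close> by (auto simp: mono_def)
    moreover have "lattice_norm (v - u) \<le> lattice_norm (v - vs ! i) + lattice_norm (vs ! i - u)"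
      using lattice_norm_triangle[of "v - vs ! i" "vs ! i - u"] by simp
    ultimately show False
      using assms(4) lattice_norm_minus[of v "vs ! i"] by simp
  qed
  then show "enat (2 * n) \<le> enat (length vs - 1)" by simp
qed

text \<open>
  The infimum in \<^const>\<open>graph_dist\<close> is attained. The right-hand side quantifies over the
  countably many vertex lists, which makes it a measurable condition on the edge set.
\<close>

lemma le_graph_dist_iff:
  "ereal L \<le> ereal_of_enat (graph_dist E u v) \<longleftrightarrow> (\<forall>vs. is_path E u vs v \<longrightarrow> L \<le> real (length vs - 1))"
proof (cases "\<exists>vs. is_path E u vs v")
  case True
  then obtain vs\<^sub>0 where "is_path E u vs\<^sub>0 v" by blast
  then have "graph_dist E u v \<in> (\<lambda>vs. enat (length vs - 1)) ` {vs. is_path E u vs v}"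
    unfolding graph_dist_def by (intro wellorder_InfI[of "enat (length vs\<^sub>0 - 1)"]) auto
  then obtain vs where vs: "is_path E u vs v" "graph_dist E u v = enat (length vs - 1)"
    by auto
  have "graph_dist E u v \<le> enat (length ws - 1)" if "is_path E u ws v" for ws
    unfolding graph_dist_def using that by (intro INF_lower) simp
  with vs show ?thesis by force
next
  case False
  then show ?thesis by (simp add: graph_dist_def top_enat_def)
qed

section \<open>Occupation probabilities of edges\<close>

context scale_free_percolation
begin

lemma weight_measurable [measurable]: "random_variable borel (W x)"
  using weights_indep by (auto simp: indep_vars_def)

lemma weight_nonneg: "AE \<omega> in M. 0 \<le> W x \<omega>"
  using weights_nonneg by (subst (asm) weights_law[of x, symmetric], subst (asm) AE_distr_iff) auto

lemma edge_measurable [measurable]: "Measurable.pred M (\<lambda>\<omega>. {x, y} \<in> G \<omega>)"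
proof (cases "x = y")
  case True
  then have "{\<omega> \<in> space M. {x, y} \<in> G \<omega>} = {}"
    using edges by (fastforce simp: doubleton_eq_iff)
  then show ?thesis unfolding pred_def by (metis sets.empty_sets)
next
  case False
  then show ?thesis by (simp add: pred_def edge_events)
qed

lemma edge_prob_integrable:
  assumes "x \<noteq> y"
  shows "integrable M (\<lambda>\<omega>. edge_prob lam \<alpha> (\<lambda>z. W z \<omega>) x y)" (is "integrable M ?p")
    and prob_edge: "prob {\<omega> \<in> space M. {x, y} \<in> G \<omega>} =
      expectation (\<lambda>\<omega>. edge_prob lam \<alpha> (\<lambda>z. W z \<omega>) x y)"
proof -
  define F where "F = vimage_algebra (space M) (\<lambda>\<omega> x. W x \<omega>) (Pi\<^sub>M UNIV (\<lambda>_. borel :: real measure))"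
  have W: "(\<lambda>\<omega> x. W x \<omega>) \<in> measurable M (Pi\<^sub>M UNIV (\<lambda>_. borel :: real measure))"
    by (rule measurable_PiM_single') auto
  have "subalgebra M F"
    unfolding subalgebra_def F_def
    using measurable_sets[OF W] measurable_space[OF W] by (auto simp: sets_vimage_algebra2)
  then interpret F: finite_measure_subalgebra M F
    by unfold_locales
  let ?E = "{\<omega> \<in> space M. {x, y} \<in> G \<omega>}"
  have E: "?E \<in> sets M" using edge_events[OF assms] .
  then have int: "integrable M (indicator ?E :: _ \<Rightarrow> real)"
    by (simp add: integrable_indicator_iff emeasure_eq_measure)
  have ae: "AE \<omega> in M. real_cond_exp M F (indicator ?E) \<omega> = ?p \<omega>"
    using edges_cond_indep[of "{(x, y)}"] assms unfolding F_def by simp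
  have meas: "?p \<in> borel_measurable M"
    unfolding edge_prob_def by measurable
  show "integrable M ?p"
    using F.real_cond_exp_int(1)[OF int] integrable_cong_AE[OF _ meas ae] by auto
  have "prob ?E = expectation (indicator ?E)"
    using E by simp
  also have "\<dots> = expectation (real_cond_exp M F (indicator ?E))"
    using F.real_cond_exp_int(2)[OF int] by simp
  also have "\<dots> = expectation ?p"
    using meas ae by (intro integral_cong_AE) auto
  finally show "prob ?E = expectation ?p" .
qed

text \<open>
  The two endpoint weights are independent, so the expectation of their product to the power
  \<open>\<beta>\<close> is the square of a single moment. The weights are truncated at 0 because their law is
  nonnegative only almost surely.
\<close>

lemma prob_edge_le:
  assumes "x \<noteq> y" "0 \<le> lam" "0 < \<beta>" "\<beta> \<le> 1"
    and moment: "integrable D (\<lambda>w. max 0 w powr \<beta>)"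
  shows "prob {\<omega> \<in> space M. {x, y} \<in> G \<omega>} \<le>
    lam powr \<beta> * (\<integral>w. max 0 w powr \<beta> \<partial>D)\<^sup>2 * lattice_norm (x - y) powr (- (\<alpha> * \<beta>))"
proof -
  let ?f = "\<lambda>z \<omega>. max 0 (W z \<omega>) powr \<beta>"
  let ?a = "lam powr \<beta> * lattice_norm (x - y) powr (- (\<alpha> * \<beta>))"
  have int: "integrable M (?f z)" for z
    using moment by (subst (asm) weights_law[of z, symmetric], subst (asm) integrable_distr_eq) auto
  have mean: "expectation (?f z) = (\<integral>w. max 0 w powr \<beta> \<partial>D)" for z
    by (subst weights_law[of z, symmetric], subst integral_distr) auto
  have indep: "indep_vars (\<lambda>_. borel) ?f {x, y}"
    by (rule indep_vars_compose2[where M' = "\<lambda>_. borel" and X = W])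
      (use indep_vars_subset[OF weights_indep] in auto)
  have prod_int: "integrable M (\<lambda>\<omega>. \<Prod>z\<in>{x, y}. ?f z \<omega>)"
    by (rule indep_vars_integrable[OF _ indep int]) simp
  have prod_mean: "expectation (\<lambda>\<omega>. \<Prod>z\<in>{x, y}. ?f z \<omega>) = (\<Prod>z\<in>{x, y}. expectation (?f z))"
    by (rule indep_vars_lebesgue_integral[OF _ indep int]) simp
  have "prob {\<omega> \<in> space M. {x, y} \<in> G \<omega>} = expectation (\<lambda>\<omega>. edge_prob lam \<alpha> (\<lambda>z. W z \<omega>) x y)"
    by (rule prob_edge[OF \<open>x \<noteq> y\<close>])
  also have "\<dots> \<le> expectation (\<lambda>\<omega>. ?a * (\<Prod>z\<in>{x, y}. ?f z \<omega>))"
  proof (rule integral_mono_AE)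
    show "integrable M (\<lambda>\<omega>. edge_prob lam \<alpha> (\<lambda>z. W z \<omega>) x y)"
      by (rule edge_prob_integrable[OF \<open>x \<noteq> y\<close>])
    show "integrable M (\<lambda>\<omega>. ?a * (\<Prod>z\<in>{x, y}. ?f z \<omega>))"
      using prod_int by simp
    show "AE \<omega> in M. edge_prob lam \<alpha> (\<lambda>z. W z \<omega>) x y \<le> ?a * (\<Prod>z\<in>{x, y}. ?f z \<omega>)"
      using weight_nonneg[of x] weight_nonneg[of y]
    proof eventually_elim
      case (elim \<omega>)
      have "edge_prob lam \<alpha> (\<lambda>z. W z \<omega>) x y
          \<le> (lam * W x \<omega> * W y \<omega> / lattice_norm (x - y) powr \<alpha>) powr \<beta>"
        unfolding edge_prob_def using assms elim by (intro one_minus_exp_le_powr) auto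
      also have "\<dots> = ?a * (\<Prod>z\<in>{x, y}. ?f z \<omega>)"
        using assms elim
        by (simp add: powr_mult powr_divide powr_powr powr_minus max_def lattice_norm_nonneg
            field_simps)
      finally show ?case .
    qed
  qed
  also have "\<dots> = ?a * (\<integral>w. max 0 w powr \<beta> \<partial>D)\<^sup>2"
    using assms(1) by (simp only: integral_mult_right_zero prod_mean mean) (simp add: power2_eq_square)
  finally show ?thesis by (simp add: mult_ac)
qed

text \<open>
  Both sums over end vertices are reduced to the same convergent lattice sum \<open>S\<close>. With \<open>s'\<close>
  slightly above the dimension, the number of vertices \<open>y\<close> in the ball is at most
  \<open>R powr s' * S\<close>, as \<open>1 \<le> (R / max 1 \<bar>y - v\<bar>) powr s'\<close> there. The part \<open>s - s'\<close> of the
  exponent of \<open>\<bar>z - y\<bar>\<close> is spent on \<open>\<bar>z - y\<bar> \<ge> R' / 2\<close>, and the remaining \<open>s'\<close> makes the sum over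
  \<open>z\<close> converge.
\<close>

lemma prob_long_edge_le:
  assumes edge_le: "\<And>y z. y \<noteq> z \<Longrightarrow>
      prob {\<omega> \<in> space M. {y, z} \<in> G \<omega>} \<le> K * lattice_norm (y - z) powr (- s)"
    and lattice_sum: "\<And>A :: (int ^ 'd) set. finite A \<Longrightarrow>
      (\<Sum>u\<in>A. max 1 (lattice_norm u) powr (- s')) \<le> S"
    and "0 \<le> K" "0 \<le> s'" "s' \<le> s" "1 \<le> R" "2 * R \<le> R'"
  shows "prob {\<omega> \<in> space M. \<exists>y z. lattice_norm (y - v) \<le> R \<and> R' < lattice_norm (z - v)
      \<and> {y, z} \<in> G \<omega>} \<le> K * S\<^sup>2 * (R powr s' * (R' / 2) powr (- (s - s')))"
proof -
  define I where "I = {(y, z). lattice_norm (y - v) \<le> R \<and> R' < lattice_norm (z - v)}"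
  let ?A = "\<lambda>(y, z). {\<omega> \<in> space M. {y, z} \<in> G \<omega>}"
  let ?c = "K * (R powr s' * (R' / 2) powr (- (s - s')))"
  let ?g = "\<lambda>u. max 1 (lattice_norm u) powr (- s')"
  have "{\<omega> \<in> space M. \<exists>y z. lattice_norm (y - v) \<le> R \<and> R' < lattice_norm (z - v)
      \<and> {y, z} \<in> G \<omega>} = (\<Union>p\<in>I. ?A p)"
    by (auto simp: I_def)
  also have "prob \<dots> \<le> ?c * S\<^sup>2"
  proof (rule measure_countable_UN_le)
    show "?A p \<in> sets M" for p
      by (cases p) simp
    fix J assume J: "finite J" "J \<subseteq> I"
    have shifted: "(\<Sum>u\<in>A. ?g (u - w)) \<le> S" if "finite A" for A and w :: "int ^ 'd"
    proof -
      have "(\<Sum>u\<in>A. ?g (u - w)) = sum ?g ((\<lambda>u. u - w) ` A)"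
        by (subst sum.reindex) (auto simp: inj_on_def)
      then show ?thesis using lattice_sum[of "(\<lambda>u. u - w) ` A"] that by simp
    qed
    have "prob (?A p) \<le> ?c * (case p of (y, z) \<Rightarrow> ?g (y - v) * ?g (z - y))" if "p \<in> J" for p
    proof -
      obtain y z where p: "p = (y, z)" by (cases p)
      with that J have yz: "lattice_norm (y - v) \<le> R" "R' < lattice_norm (z - v)"
        by (auto simp: I_def)
      let ?r = "lattice_norm (z - y)"
      have "lattice_norm (z - v) \<le> ?r + lattice_norm (y - v)"
        using lattice_norm_triangle[of "z - y" "y - v"] by simp
      with yz assms have r: "R' / 2 \<le> ?r" "1 \<le> ?r" by auto
      have "?r powr (- s) = ?r powr (- (s - s')) * ?r powr (- s')"
        by (simp add: powr_add[symmetric])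
      also have "\<dots> \<le> (R' / 2) powr (- (s - s')) * ?g (z - y)"
        using r assms by (intro mult_mono powr_mono2') auto
      also have "\<dots> \<le> (R' / 2) powr (- (s - s')) * ?g (z - y) * (R powr s' * ?g (y - v))"
      proof -
        have "1 = R powr s' * R powr (- s')"
          using \<open>1 \<le> R\<close> by (simp add: powr_add[symmetric])
        also have "\<dots> \<le> R powr s' * ?g (y - v)"
          using yz assms by (intro mult_left_mono powr_mono2') auto
        finally have "1 \<le> R powr s' * ?g (y - v)" .
        from mult_left_mono[OF this, of "(R' / 2) powr (- (s - s')) * ?g (z - y)"]
        show ?thesis by simp
      qed
      finally have decay: "?r powr (- s) \<le>
          (R' / 2) powr (- (s - s')) * ?g (z - y) * (R powr s' * ?g (y - v))" .
      have "y \<noteq> z" using yz assms by auto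
      then have "prob (?A p) \<le> K * ?r powr (- s)"
        using edge_le[of y z] by (simp add: p lattice_norm_minus[of z y])
      also have "\<dots> \<le> K * ((R' / 2) powr (- (s - s')) * ?g (z - y) * (R powr s' * ?g (y - v)))"
        using decay \<open>0 \<le> K\<close> by (rule mult_left_mono)
      finally show ?thesis
        by (simp add: p mult_ac)
    qed
    then have "(\<Sum>p\<in>J. prob (?A p)) \<le> (\<Sum>p\<in>J. ?c * (case p of (y, z) \<Rightarrow> ?g (y - v) * ?g (z - y)))"
      by (rule sum_mono)
    also have "\<dots> \<le> (\<Sum>p\<in>fst ` J \<times> snd ` J. ?c * (case p of (y, z) \<Rightarrow> ?g (y - v) * ?g (z - y)))"
      using J \<open>0 \<le> K\<close> by (intro sum_mono2) (auto intro: rev_image_eqI)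
    also have "\<dots> = ?c * (\<Sum>y\<in>fst ` J. ?g (y - v) * (\<Sum>z\<in>snd ` J. ?g (z - y)))"
      by (simp add: sum_distrib_left sum.cartesian_product split_def)
    also have "\<dots> \<le> ?c * (\<Sum>y\<in>fst ` J. ?g (y - v) * S)"
      using J \<open>0 \<le> K\<close> by (intro mult_left_mono sum_mono shifted) auto
    also have "\<dots> \<le> ?c * (S * S)"
      using shifted[of "fst ` J" v] shifted[of "{}"] J \<open>0 \<le> K\<close>
      by (simp add: sum_distrib_right[symmetric] mult_left_mono mult_right_mono)
    finally show "(\<Sum>p\<in>J. prob (?A p)) \<le> ?c * S\<^sup>2"
      by (simp add: power2_eq_square)
  qed auto
  finally show ?thesis by (simp add: mult_ac)
qed

section \<open>Escape probabilities\<close>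

lemma graph_dist_measurable:
  "{\<omega> \<in> space M. ereal L \<le> ereal_of_enat (graph_dist (G \<omega>) u v)} \<in> sets M"
proof -
  have [measurable]: "Measurable.pred M (\<lambda>\<omega>. successively (\<lambda>a b. {a, b} \<in> G \<omega>) vs)" for vs
    by (induction vs rule: induct_list012) simp_all
  show ?thesis
    unfolding le_graph_dist_iff is_path_def by measurable
qed

text \<open>
  At step \<open>k\<close> the bound for long edges is a multiple of \<open>exp (- \<rho> * h * q ^ k)\<close>. Weakening
  this to \<open>1 / (\<rho> * h * q ^ k)\<close> leaves a geometric series and still a factor \<open>1 / h\<close>, so the total
  can be made arbitrarily small by the choice of the initial radius \<open>exp h\<close>, uniformly in \<open>n\<close>.
  The lower bound on \<open>h\<close> makes each radius at least twice the preceding one.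
\<close>

lemma prob_escape_le:
  assumes edge_le: "\<And>y z. y \<noteq> z \<Longrightarrow>
      prob {\<omega> \<in> space M. {y, z} \<in> G \<omega>} \<le> K * lattice_norm (y - z) powr (- s)"
    and lattice_sum: "\<And>A :: (int ^ 'd) set. finite A \<Longrightarrow>
      (\<Sum>u\<in>A. max 1 (lattice_norm u) powr (- s')) \<le> S"
    and "0 \<le> K" "0 \<le> s'" "s' \<le> s" "1 < q" "0 < \<rho>" "\<rho> = (s - s') * q - s'" "0 < h" "ln 2 \<le> h * (q - 1)"
  shows "prob {\<omega> \<in> space M. \<exists>k<n. \<exists>y z. lattice_norm (y - v) \<le> exp (h * q ^ k) \<and>
      exp (h * q ^ Suc k) < lattice_norm (z - v) \<and> {y, z} \<in> G \<omega>}
    \<le> K * S\<^sup>2 * 2 powr (s - s') / \<rho> * (q / (q - 1)) / h"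
proof -
  let ?C = "K * S\<^sup>2 * 2 powr (s - s')"
  let ?A = "\<lambda>k. {\<omega> \<in> space M. \<exists>y z. lattice_norm (y - v) \<le> exp (h * q ^ k) \<and>
      exp (h * q ^ Suc k) < lattice_norm (z - v) \<and> {y, z} \<in> G \<omega>}"
  have step: "prob (?A k) \<le> ?C / (\<rho> * h) * (1 / q) ^ k" for k
  proof -
    have "1 \<le> q ^ k" using \<open>1 < q\<close> by (simp add: one_le_power)
    have "ln 2 \<le> ln 2 * q ^ k"
      using \<open>1 \<le> q ^ k\<close> by simp
    also have "\<dots> \<le> h * (q - 1) * q ^ k"
      using assms(10) \<open>1 \<le> q ^ k\<close> by (intro mult_right_mono) auto
    finally have "ln 2 + h * q ^ k \<le> h * (q - 1) * q ^ k + h * q ^ k"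
      by simp
    also have "\<dots> = h * q ^ Suc k" by (simp add: algebra_simps)
    finally have "exp (ln 2 + h * q ^ k) \<le> exp (h * q ^ Suc k)" by simp
    then have double: "2 * exp (h * q ^ k) \<le> exp (h * q ^ Suc k)" by (simp add: exp_add)
    have "exp (h * q ^ k) powr s' = exp (s' * (h * q ^ k))"
      by (simp add: powr_def)
    moreover have "(exp (h * q ^ Suc k) / 2) powr (- (s - s')) =
        exp ((s' - s) * (h * q ^ Suc k)) * 2 powr (s - s')"
      by (simp add: powr_def ln_div exp_add[symmetric] algebra_simps)
    moreover have "s' * (h * q ^ k) + (s' - s) * (h * q ^ Suc k) = - (\<rho> * h * q ^ k)"
      by (simp add: assms(8) algebra_simps)
    ultimately have radii: "exp (h * q ^ k) powr s' * (exp (h * q ^ Suc k) / 2) powr (- (s - s'))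
        = 2 powr (s - s') * exp (- (\<rho> * h * q ^ k))"
      by (simp add: exp_add[symmetric])
    have "\<rho> * h * q ^ k \<le> exp (\<rho> * h * q ^ k)"
      using exp_ge_add_one_self[of "\<rho> * h * q ^ k"] by linarith
    then have exp_le: "exp (- (\<rho> * h * q ^ k)) \<le> 1 / (\<rho> * h * q ^ k)"
      using assms by (simp add: exp_minus inverse_eq_divide frac_le)
    have "prob (?A k) \<le> K * S\<^sup>2 * (exp (h * q ^ k) powr s' * (exp (h * q ^ Suc k) / 2) powr (- (s - s')))"
      using assms \<open>1 < q\<close> \<open>1 \<le> q ^ k\<close> double by (intro prob_long_edge_le) auto
    also have "\<dots> = ?C * exp (- (\<rho> * h * q ^ k))"
      unfolding radii by simp
    also have "\<dots> \<le> ?C * (1 / (\<rho> * h * q ^ k))"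
      using exp_le \<open>0 \<le> K\<close> by (intro mult_left_mono) auto
    finally show ?thesis
      by (simp add: power_divide mult_ac)
  qed
  have "prob {\<omega> \<in> space M. \<exists>k<n. \<exists>y z. lattice_norm (y - v) \<le> exp (h * q ^ k) \<and>
      exp (h * q ^ Suc k) < lattice_norm (z - v) \<and> {y, z} \<in> G \<omega>} = prob (\<Union>k<n. ?A k)"
    by (rule arg_cong[where f = prob]) auto
  also have "\<dots> \<le> (\<Sum>k<n. prob (?A k))"
    by (intro measure_UNION_le) auto
  also have "\<dots> \<le> (\<Sum>k<n. ?C / (\<rho> * h) * (1 / q) ^ k)"
    by (intro sum_mono step)
  also have "\<dots> = ?C / (\<rho> * h) * (\<Sum>k<n. (1 / q) ^ k)"
    by (simp add: sum_distrib_left)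
  also have "\<dots> \<le> ?C / (\<rho> * h) * (1 / (1 - 1 / q))"
  proof (intro mult_left_mono)
    have "(\<Sum>k<n. (1 / q) ^ k) \<le> (\<Sum>k. (1 / q) ^ k)"
      using \<open>1 < q\<close> by (intro sum_le_suminf summable_geometric) auto
    then show "(\<Sum>k<n. (1 / q) ^ k) \<le> 1 / (1 - 1 / q)"
      using \<open>1 < q\<close> by (simp add: suminf_geometric)
  qed (use assms in auto)
  also have "\<dots> = ?C / \<rho> * (q / (q - 1)) / h"
    using \<open>1 < q\<close> by (simp add: field_simps)
  finally show ?thesis .
qed

lemma prob_graph_dist_ge:
  assumes edge_le: "\<And>y z. y \<noteq> z \<Longrightarrow>
      prob {\<omega> \<in> space M. {y, z} \<in> G \<omega>} \<le> K * lattice_norm (y - z) powr (- s)"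
    and lattice_sum: "\<And>A :: (int ^ 'd) set. finite A \<Longrightarrow>
      (\<Sum>u\<in>A. max 1 (lattice_norm u) powr (- s')) \<le> S"
    and "0 \<le> K" "0 \<le> s'" "s' \<le> s" "1 < q" "0 < \<rho>" "\<rho> = (s - s') * q - s'" "0 < h" "ln 2 \<le> h * (q - 1)"
    and far: "2 * exp (h * q ^ n) < lattice_norm x" and "L \<le> 2 * real n"
  shows "1 - 2 * (K * S\<^sup>2 * 2 powr (s - s') / \<rho> * (q / (q - 1)) / h)
    \<le> prob {\<omega> \<in> space M. ereal L \<le> ereal_of_enat (graph_dist (G \<omega>) 0 x)}"
proof -
  let ?B = "\<lambda>v. {\<omega> \<in> space M. \<exists>k<n. \<exists>y z. lattice_norm (y - v) \<le> exp (h * q ^ k) \<and>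
      exp (h * q ^ Suc k) < lattice_norm (z - v) \<and> {y, z} \<in> G \<omega>}"
  let ?E = "{\<omega> \<in> space M. ereal L \<le> ereal_of_enat (graph_dist (G \<omega>) 0 x)}"
  have [measurable]: "?B v \<in> sets M" for v
    by measurable
  have "space M - ?E \<subseteq> ?B 0 \<union> ?B x"
  proof (rule ccontr)
    assume "\<not> space M - ?E \<subseteq> ?B 0 \<union> ?B x"
    then obtain \<omega> where \<omega>: "\<omega> \<in> space M" "\<omega> \<notin> ?E" "\<omega> \<notin> ?B 0" "\<omega> \<notin> ?B x"
      by blast
    have "enat (2 * n) \<le> graph_dist (G \<omega>) 0 x"
    proof (rule graph_dist_ge_if_confined)
      show "lattice_norm (z - w) \<le> exp (h * q ^ Suc k)"
        if "w \<in> {0, x}" "k < n" "lattice_norm (y - w) \<le> exp (h * q ^ k)" "{y, z} \<in> G \<omega>" for w k y z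
      proof (rule ccontr)
        assume "\<not> lattice_norm (z - w) \<le> exp (h * q ^ Suc k)"
        then have "\<omega> \<in> ?B w"
          using that(2-4) \<omega>(1) by (simp only: not_le) blast
        then show False using that(1) \<omega> by blast
      qed
      show "mono (\<lambda>k. exp (h * q ^ k))"
        using assms by (auto simp: mono_def intro!: mult_left_mono power_increasing)
    qed (use far in auto)
    then have "ereal_of_enat (enat (2 * n)) \<le> ereal_of_enat (graph_dist (G \<omega>) 0 x)"
      by (simp only: ereal_of_enat_le_iff)
    then have "ereal L \<le> ereal_of_enat (graph_dist (G \<omega>) 0 x)"
      using \<open>L \<le> 2 * real n\<close> by (auto elim: order_trans[rotated])
    with \<omega> show False by simp
  qed
  then have "prob (space M - ?E) \<le> prob (?B 0 \<union> ?B x)"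
    by (intro finite_measure_mono) auto
  also have "\<dots> \<le> prob (?B 0) + prob (?B x)"
    by (intro measure_Un_le) auto
  also have "\<dots> \<le> 2 * (K * S\<^sup>2 * 2 powr (s - s') / \<rho> * (q / (q - 1)) / h)"
    using prob_escape_le[OF edge_le lattice_sum assms(3-10), of n 0]
      prob_escape_le[OF edge_le lattice_sum assms(3-10), of n x] by simp
  finally show ?thesis
    using prob_compl[OF graph_dist_measurable[of L 0 x]] by simp
qed

end

section \<open>Choice of exponents and number of steps\<close>

text \<open>
  At the limiting values \<open>\<beta> = \<beta>\<^sub>0\<close> and \<open>s' = d\<close>, the last inequality of the conclusion is the
  hypothesis on \<open>q\<close>; strictness leaves room on both sides.
\<close>

lemma ex_exponents:
  fixes d \<alpha> \<beta>\<^sub>0 q :: real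
  assumes "0 < d" "0 < \<alpha>" "d < \<alpha> * \<beta>\<^sub>0" "0 < q" "1 < q * (\<alpha> * \<beta>\<^sub>0 / d - 1)"
  obtains \<beta> s' where "0 < \<beta>" "\<beta> < \<beta>\<^sub>0" "d < s'" "s' \<le> \<alpha> * \<beta>" "0 < (\<alpha> * \<beta> - s') * q - s'"
proof -
  have "(1 + q) * d < q * (\<alpha> * \<beta>\<^sub>0)"
    using assms by (simp add: field_simps)
  then have "d < q * (\<alpha> * \<beta>\<^sub>0) / (1 + q)"
    using \<open>0 < q\<close> by (simp add: field_simps)
  then obtain s' where s': "d < s'" "s' < q * (\<alpha> * \<beta>\<^sub>0) / (1 + q)"
    using dense by blast
  then have "(1 + q) * s' / (q * \<alpha>) < \<beta>\<^sub>0"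
    using assms by (simp add: field_simps)
  then obtain \<beta> where \<beta>: "(1 + q) * s' / (q * \<alpha>) < \<beta>" "\<beta> < \<beta>\<^sub>0"
    using dense by blast
  have "0 < (1 + q) * s' / (q * \<alpha>)"
    using assms s' by simp
  then have "0 < \<beta>" using \<beta> by simp
  have gap: "0 < (\<alpha> * \<beta> - s') * q - s'"
    using \<beta> assms by (simp add: field_simps)
  then have "0 < (\<alpha> * \<beta> - s') * q" using s' assms by linarith
  then have "s' \<le> \<alpha> * \<beta>"
    using \<open>0 < q\<close> by (simp add: zero_less_mult_iff)
  with \<open>0 < \<beta>\<close> \<beta> s' gap show thesis by (intro that)
qed

text \<open>
  With \<open>n\<close> the exponent of the iterated exponential and \<open>a\<close> in the role of \<open>\<bar>ln \<kappa>\<bar>\<close>,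
  \<open>exp ((1 + \<eta>) * a) ^ n\<close> is about \<open>ln r powr ((1 + \<eta>) * (1 - \<eta>))\<close>, with exponent
  \<open>1 - \<eta>\<^sup>2 < 1\<close>.
\<close>

lemma eventually_iterated_radius_lt:
  fixes a h \<eta> :: real
  assumes "0 < a" "0 < \<eta>" "0 < h"
  shows "eventually (\<lambda>r. 2 * exp (h * exp ((1 + \<eta>) * a) ^ nat \<lceil>(1 - \<eta>) * ln (ln r) / a\<rceil>) < r) at_top"
proof -
  let ?q = "exp ((1 + \<eta>) * a)"
  (* For \<eta> > 1 the power ln r powr (1 - \<eta>\<^sup>2) is smaller than 1 = ?q ^ 0, so the exponent is
     replaced by a positive one, still below 1. *)
  define \<theta> where "\<theta> = max (1 / 2) (1 - \<eta>\<^sup>2)"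
  have \<theta>: "0 < \<theta>" "\<theta> < 1" "1 - \<eta>\<^sup>2 \<le> \<theta>"
    using assms by (auto simp: \<theta>_def)
  have "eventually (\<lambda>r :: real. C * ln r powr \<theta> + ln 2 < ln r) at_top" if "0 < C" for C
    using \<theta>(1,2) that by real_asymp
  then have large: "eventually (\<lambda>r :: real. h * ?q * ln r powr \<theta> + ln 2 < ln r) at_top"
    using \<open>0 < h\<close> by simp
  show ?thesis
    using large eventually_gt_at_top[of "exp 1"]
  proof eventually_elim
    case (elim r)
    have "0 < r" using elim(2) exp_gt_zero[of "1 :: real"] by linarith
    with elim(2) have r: "0 < r" "1 < ln r" by (auto dest: ln_less_cancel_iff[THEN iffD2, rotated 2])
    let ?t = "(1 - \<eta>) * ln (ln r) / a"
    have "?q ^ nat \<lceil>?t\<rceil> \<le> ?q * ln r powr \<theta>"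
    proof -
      have "real (nat \<lceil>?t\<rceil>) \<le> max 0 ?t + 1"
        by linarith
      then have "?q ^ nat \<lceil>?t\<rceil> \<le> exp ((1 + \<eta>) * a * (max 0 ?t + 1))"
        using assms by (simp add: exp_of_nat_mult[symmetric] mult.commute mult_left_mono)
      also have "\<dots> = ?q * exp ((1 + \<eta>) * a * max 0 ?t)"
        by (simp add: distrib_left exp_add)
      also have "exp ((1 + \<eta>) * a * max 0 ?t) \<le> ln r powr \<theta>"
      proof (cases "0 \<le> ?t")
        case True
        have "(1 + \<eta>) * a * ?t = (1 - \<eta>\<^sup>2) * ln (ln r)"
          using assms by (simp add: field_simps power2_eq_square)
        then have "exp ((1 + \<eta>) * a * max 0 ?t) = ln r powr (1 - \<eta>\<^sup>2)"
          using True r by (auto simp: powr_def max_def)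
        also have "\<dots> \<le> ln r powr \<theta>"
          using r \<theta> by (intro powr_mono) auto
        finally show ?thesis .
      next
        case False
        then show ?thesis
          using r \<theta> ge_one_powr_ge_zero[of "ln r" \<theta>] by (simp add: max_def)
      qed
      finally show ?thesis by simp
    qed
    then have "h * ?q ^ nat \<lceil>?t\<rceil> \<le> h * (?q * ln r powr \<theta>)"
      using \<open>0 < h\<close> by (intro mult_left_mono) auto
    also have "\<dots> < ln r - ln 2"
      using elim(1) by (simp add: mult_ac)
    finally have "exp (ln 2 + h * ?q ^ nat \<lceil>?t\<rceil>) < exp (ln r)"
      by simp
    then show ?case
      using r by (simp add: exp_add)
  qed
qed

section \<open>The doubly logarithmic lower bound\<close>

theorem theorem5p2:
  fixes M :: "'a measure"
    and W :: "int ^ 'd::finite \<Rightarrow> 'a \<Rightarrow> real"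
    and G :: "'a \<Rightarrow> (int ^ 'd) set set"
    and D :: "real measure"
    and lam \<alpha> \<tau> c \<gamma> \<kappa> \<eta> :: real
  assumes "scale_free_percolation M lam \<alpha> D W G"
    and "\<alpha> > real CARD('d)" and "lam > 0"
    and normalization: "integrable D (\<lambda>w. w) \<Longrightarrow> (\<integral>w. w \<partial>D) = 1"
    and "\<tau> > 1" and "c > 0"
    and tail: "\<And>w. w > 0 \<Longrightarrow> measure D {w<..} \<le> c * w powr (- (\<tau> - 1))"
    and "\<gamma> = \<alpha> * (\<tau> - 1) / real CARD('d)" and "1 < \<gamma>" and "\<gamma> < 2"
    and "\<kappa> = (if \<tau> \<le> 2 then \<gamma> - 1 else \<alpha> / real CARD('d) - 1)"
    and "\<eta> > 0"
  shows "((\<lambda>x :: int ^ 'd. measure M {\<omega> \<in> space M.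
            ereal_of_enat (graph_dist (G \<omega>) 0 x)
              \<ge> ereal ((1 - \<eta>) * (2 * ln (ln (lattice_norm x)) / \<bar>ln \<kappa>\<bar>))})
          \<longlongrightarrow> 1) (filtercomap lattice_norm at_top)"
proof -
  interpret scale_free_percolation M lam \<alpha> D W G by fact
  let ?d = "real CARD('d)"
  have d: "0 < ?d" by simp
  with \<open>\<alpha> > ?d\<close> have "0 < \<alpha>" by linarith
  define \<beta>\<^sub>0 where "\<beta>\<^sub>0 = min (\<tau> - 1) 1"
  have \<kappa>_eq: "\<kappa> = \<alpha> * \<beta>\<^sub>0 / ?d - 1"
    using assms(8,11) by (simp add: \<beta>\<^sub>0_def min_def)
  have "0 < \<kappa>"
    using assms(2,9,11) d by (simp add: field_simps)
  have "\<kappa> < 1"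
  proof -
    have "\<alpha> * \<beta>\<^sub>0 / ?d \<le> \<gamma>"
      unfolding assms(8) using \<open>0 < \<alpha>\<close> by (intro divide_right_mono mult_left_mono) (auto simp: \<beta>\<^sub>0_def)
    then show ?thesis using \<kappa>_eq \<open>\<gamma> < 2\<close> by simp
  qed
  define a where "a = \<bar>ln \<kappa>\<bar>"
  have a: "0 < a" "exp a * \<kappa> = 1"
    using \<open>0 < \<kappa>\<close> \<open>\<kappa> < 1\<close> by (auto simp: a_def abs_if exp_minus)
  define q where "q = exp ((1 + \<eta>) * a)"
  have "1 < q" using a \<open>\<eta> > 0\<close> by (simp add: q_def)
  have "q = exp (\<eta> * a) * exp a"
    by (simp add: q_def exp_add[symmetric] algebra_simps)
  then have "q * \<kappa> = exp (\<eta> * a)"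
    using a(2) by simp
  then have "1 < q * \<kappa>" using a \<open>\<eta> > 0\<close> by simp
  moreover have "?d < \<alpha> * \<beta>\<^sub>0"
    using \<open>0 < \<kappa>\<close> d by (simp add: \<kappa>_eq field_simps)
  ultimately obtain \<beta> s' where \<beta>: "0 < \<beta>" "\<beta> < \<beta>\<^sub>0" and s': "?d < s'" "s' \<le> \<alpha> * \<beta>"
    and gap: "0 < (\<alpha> * \<beta> - s') * q - s'"
    using ex_exponents[of ?d \<alpha> \<beta>\<^sub>0 q] d \<open>0 < \<alpha>\<close> \<open>1 < q\<close> \<kappa>_eq by auto
  obtain S where S: "0 < S"
    "\<And>A :: (int ^ 'd) set. finite A \<Longrightarrow> (\<Sum>u\<in>A. max 1 (lattice_norm u) powr (- s')) \<le> S"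
    using lattice_sum_bounded[OF s'(1)] by blast
  interpret D: real_distribution D
    unfolding weights_law[of 0, symmetric] by (rule real_distribution_distr) simp
  have moment: "integrable D (\<lambda>w. max 0 w powr \<beta>)"
    using tail \<beta> by (intro D.fractional_moment_finite[of c "\<tau> - 1"]) (auto simp: \<beta>\<^sub>0_def)
  define K where "K = lam powr \<beta> * (\<integral>w. max 0 w powr \<beta> \<partial>D)\<^sup>2"
  have "0 \<le> K" by (simp add: K_def)
  have edge_le: "prob {\<omega> \<in> space M. {y, z} \<in> G \<omega>} \<le> K * lattice_norm (y - z) powr (- (\<alpha> * \<beta>))"
    if "y \<noteq> z" for y z
    unfolding K_def using that \<beta> \<open>lam > 0\<close> by (intro prob_edge_le moment) (auto simp: \<beta>\<^sub>0_def)
  define C where "C = K * S\<^sup>2 * 2 powr (\<alpha> * \<beta> - s') / ((\<alpha> * \<beta> - s') * q - s') * (q / (q - 1))"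
  show ?thesis
  proof (rule tendstoI)
    fix \<epsilon> :: real assume "0 < \<epsilon>"
    (* The first entry makes the radii at least double, the second makes the failure probability
       2 * C / h smaller than \<epsilon>. *)
    define h where "h = max (ln 2 / (q - 1)) (2 * C / \<epsilon> + 1)"
    have "0 < ln 2 / (q - 1)" using \<open>1 < q\<close> by simp
    then have "0 < h" unfolding h_def by linarith
    have "ln 2 \<le> h * (q - 1)"
      using \<open>1 < q\<close> by (simp add: h_def pos_divide_le_eq[symmetric])
    have "2 * C / \<epsilon> < h" by (simp add: h_def)
    then have small: "2 * (C / h) < \<epsilon>"
      using \<open>0 < h\<close> \<open>0 < \<epsilon>\<close> by (simp add: field_simps)
    have "eventually (\<lambda>x :: int ^ 'd. 2 * exp (h * q ^ nat \<lceil>(1 - \<eta>) * ln (ln (lattice_norm x)) / a\<rceil>)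
        < lattice_norm x) (filtercomap lattice_norm at_top)"
      unfolding q_def
      by (rule eventually_filtercomapI[OF eventually_iterated_radius_lt[OF a(1) \<open>\<eta> > 0\<close> \<open>0 < h\<close>]])
    then show "eventually (\<lambda>x :: int ^ 'd. dist (measure M {\<omega> \<in> space M.
            ereal_of_enat (graph_dist (G \<omega>) 0 x)
              \<ge> ereal ((1 - \<eta>) * (2 * ln (ln (lattice_norm x)) / \<bar>ln \<kappa>\<bar>))}) 1 < \<epsilon>)
        (filtercomap lattice_norm at_top)"
    proof eventually_elim
      case (elim x)
      let ?L = "(1 - \<eta>) * (2 * ln (ln (lattice_norm x)) / \<bar>ln \<kappa>\<bar>)"
      let ?n = "nat \<lceil>(1 - \<eta>) * ln (ln (lattice_norm x)) / a\<rceil>"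
      have "?L = 2 * ((1 - \<eta>) * ln (ln (lattice_norm x)) / a)"
        by (simp add: a_def)
      also have "\<dots> \<le> 2 * real ?n"
        by (intro mult_left_mono real_nat_ceiling_ge) simp
      finally have "1 - 2 * (C / h) \<le>
          prob {\<omega> \<in> space M. ereal ?L \<le> ereal_of_enat (graph_dist (G \<omega>) 0 x)}"
        unfolding C_def using s' gap \<open>1 < q\<close> \<open>0 < h\<close> \<open>0 \<le> K\<close> \<open>ln 2 \<le> h * (q - 1)\<close> elim
        by (intro prob_graph_dist_ge[OF edge_le S(2)]) auto
      then show ?case
        using small prob_le_1[of "{\<omega> \<in> space M. ereal ?L \<le> ereal_of_enat (graph_dist (G \<omega>) 0 x)}"]
        by (simp add: dist_real_def)
    qed
  qed
qed

end
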